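(* Let $E$ be a real Banach space that is lush. Then $E$ has the Mazur-Ulam property: for every real Banach space $F$ and every surjective isometry $T:S_E\to S_F$, there is a linear isometry $\widetilde T$ from $E$ onto $F$ with $\widetilde T|_{S_E}=T$.
   Context: All spaces are over the real field. $B_E$, $S_E$, $E^*$ denote the closed unit ball, the unit sphere and the dual of $E$. An isometry is a distance-preserving map. A Banach space $E$ is lush if for every $x,y\in S_E$ and every $\varepsilon>0$ there is $x^*\in S_{E^*}$ such that, with $S=S(x^*,\varepsilon)=\{z\in B_E: x^*(z)>1-\varepsilon\}$, $x\in S$ and $\mathrm{dist}(y,\mathrm{aco}(S))<\varepsilon$, where $\mathrm{aco}$ denotes the absolutely convex hull. *)

theory Defs
  imports "HOL-Analysis.Analysis"
begin

definition absolutely_convex :: "'a::real_vector set \<Rightarrow> bool" where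
  "absolutely_convex A \<longleftrightarrow>
     (\<forall>x\<in>A. \<forall>y\<in>A. \<forall>a b. \<bar>a\<bar> + \<bar>b\<bar> \<le> 1 \<longrightarrow> a *\<^sub>R x + b *\<^sub>R y \<in> A)"

abbreviation aco :: "'a::real_vector set \<Rightarrow> 'a set" where
  "aco A \<equiv> absolutely_convex hull A"

definition slice :: "('a::real_normed_vector \<Rightarrow>\<^sub>L real) \<Rightarrow> real \<Rightarrow> 'a set" where
  "slice f \<epsilon> = {z \<in> cball 0 1. blinfun_apply f z > 1 - \<epsilon>}"

text \<open>The space is the whole type, passed as a type token. Since \<open>x\<close> lies in the slice, the set
  whose distance to \<open>y\<close> is taken is nonempty, so the convention \<open>infdist y {} = 0\<close> plays no role.\<close>

definition lush :: "'a::banach itself \<Rightarrow> bool" where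
  "lush _ \<longleftrightarrow>
     (\<forall>x\<in>sphere (0::'a) 1. \<forall>y\<in>sphere (0::'a) 1. \<forall>\<epsilon>>0.
        \<exists>f\<in>sphere (0 :: 'a \<Rightarrow>\<^sub>L real) 1.
          x \<in> slice f \<epsilon> \<and> infdist y (aco (slice f \<epsilon>)) < \<epsilon>)"

definition isometry_on :: "'a::metric_space set \<Rightarrow> ('a \<Rightarrow> 'b::metric_space) \<Rightarrow> bool" where
  "isometry_on A T \<longleftrightarrow> (\<forall>x\<in>A. \<forall>y\<in>A. dist (T x) (T y) = dist x y)"

end

theory Submission
  imports Defs
begin

text \<open>
  Let \<open>f\<close> be the functional that lushness provides for a pair \<open>p\<close>, \<open>x\<close>. It almost attains its norm
  at \<open>p\<close>, hence \<open>f x\<close> is almost at most the one-sided derivative of the norm at \<open>p\<close> in direction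
  \<open>x\<close>; and as \<open>x\<close> is almost an absolutely convex combination of the slice \<open>S\<close> of \<open>f\<close>, its distances
  to \<open>S\<close> and \<open>- S\<close> are about \<open>1 - f x\<close> and \<open>1 + f x\<close>. Distances survive under \<open>T\<close>, which bounds the
  derivatives of the norm at \<open>T p\<close> and at \<open>- T (- p)\<close> in direction \<open>T x\<close>. If \<open>p\<close>, \<open>T p\<close> and
  \<open>- T (- p)\<close> are smooth in the relevant directions, the derivative at \<open>T p\<close> towards \<open>T x\<close> equals the
  one at \<open>p\<close> towards \<open>x\<close>. For finitely many directions such points \<open>p\<close> are dense in the sphere, by
  Baire's theorem as in Mazur's theorem on smooth points. Since derivatives at smooth points are
  linear, and near the direction of \<open>v\<close> they recover the norm of \<open>v\<close>, the radial extension of \<open>T\<close>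
  preserves the norms of sums, which forces linearity.
\<close>

section \<open>One-sided directional derivatives of the norm\<close>

text \<open>Convexity: \<open>p + s *\<^sub>R h\<close> lies on the segment from \<open>p\<close> to
  \<open>p + t *\<^sub>R h\<close>.\<close>

lemma norm_quotient_mono:
  fixes p h :: "'a::real_normed_vector"
  assumes "0 < s" "s \<le> t"
  shows "(norm (p + s *\<^sub>R h) - norm p) / s \<le> (norm (p + t *\<^sub>R h) - norm p) / t"
proof -
  have t: "0 < t" using assms by simp
  have r: "0 \<le> s / t" "s / t \<le> 1" using assms t by auto
  have "p + s *\<^sub>R h = (1 - s / t) *\<^sub>R p + (s / t) *\<^sub>R (p + t *\<^sub>R h)"
    using t by (simp add: algebra_simps)
  then have "norm (p + s *\<^sub>R h)
      \<le> norm ((1 - s / t) *\<^sub>R p) + norm ((s / t) *\<^sub>R (p + t *\<^sub>R h))"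
    by (metis norm_triangle_ineq)
  also have "\<dots> = (1 - s / t) * norm p + (s / t) * norm (p + t *\<^sub>R h)"
    using r assms t by simp
  finally have "norm (p + s *\<^sub>R h) - norm p \<le> (s / t) * (norm (p + t *\<^sub>R h) - norm p)"
    by (simp add: algebra_simps)
  then show ?thesis using assms t by (simp add: field_simps)
qed

lemma norm_quotient_ge:
  fixes p h :: "'a::real_normed_vector"
  assumes "0 < t"
  shows "- norm h \<le> (norm (p + t *\<^sub>R h) - norm p) / t"
proof -
  have "norm p \<le> norm (p + t *\<^sub>R h) + norm (t *\<^sub>R h)"
    by (metis add_diff_cancel_right' norm_triangle_ineq4)
  then show ?thesis using assms by (simp add: field_simps)
qed

text \<open>The right-hand Gateaux derivative of the norm. The quotients grow with \<open>t\<close>,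
  so their limit at 0 is the infimum, which is finite because \<open>- norm h\<close> bounds them
  below.\<close>

definition norm_deriv :: "'a::real_normed_vector \<Rightarrow> 'a \<Rightarrow> real" where
  "norm_deriv p h = (INF t\<in>{0<..}. (norm (p + t *\<^sub>R h) - norm p) / t)"

lemma norm_deriv_le_quotient:
  assumes "0 < t"
  shows "norm_deriv p h \<le> (norm (p + t *\<^sub>R h) - norm p) / t"
  unfolding norm_deriv_def
proof (rule cINF_lower)
  show "bdd_below ((\<lambda>t. (norm (p + t *\<^sub>R h) - norm p) / t) ` {0<..})"
    by (rule bdd_belowI[of _ "- norm h"]) (use norm_quotient_ge in fastforce)
qed (use assms in auto)

text \<open>By monotonicity small steps decide. The bound \<open>t \<le> 1\<close> lets
  \<open>1 - t\<close> serve as a convex weight in \<open>norm_deriv_lush_ge\<close>.\<close>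

lemma norm_deriv_geI:
  assumes "\<And>t. 0 < t \<Longrightarrow> t \<le> 1 \<Longrightarrow> c \<le> (norm (p + t *\<^sub>R h) - norm p) / t"
  shows "c \<le> norm_deriv p h"
  unfolding norm_deriv_def
proof (rule cINF_greatest)
  fix t :: real assume "t \<in> {0<..}"
  then have t: "0 < t" by simp
  have "c \<le> (norm (p + min t 1 *\<^sub>R h) - norm p) / min t 1"
    by (rule assms) (use t in auto)
  also have "\<dots> \<le> (norm (p + t *\<^sub>R h) - norm p) / t"
    by (rule norm_quotient_mono) (use t in auto)
  finally show "c \<le> (norm (p + t *\<^sub>R h) - norm p) / t" .
qed auto

lemma norm_deriv_lessE:
  assumes "norm_deriv p h < c"
  obtains t where "0 < t" "(norm (p + t *\<^sub>R h) - norm p) / t < c"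
  using norm_deriv_geI[of c p h] assms by (meson not_le)

lemma norm_deriv_zero [simp]: "norm_deriv p 0 = 0"
  unfolding norm_deriv_def by simp

lemma norm_deriv_le_norm: "norm_deriv p h \<le> norm h"
proof -
  have "norm_deriv p h \<le> norm (p + h) - norm p"
    using norm_deriv_le_quotient[of 1 p h] by simp
  also have "\<dots> \<le> norm h" using norm_triangle_ineq[of p h] by simp
  finally show ?thesis .
qed

lemma norm_deriv_self: "norm_deriv p p \<ge> norm p"
proof (rule norm_deriv_geI)
  fix t :: real assume t: "0 < t"
  have "norm (p + t *\<^sub>R p) = (1 + t) * norm p"
    using t by (metis abs_of_pos add_pos_pos norm_scaleR scaleR_add_left scaleR_one zero_less_one)
  then show "norm p \<le> (norm (p + t *\<^sub>R p) - norm p) / t"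
    using t by (simp add: algebra_simps)
qed

lemma norm_deriv_scale_le:
  assumes "0 < c"
  shows "c * norm_deriv p h \<le> norm_deriv p (c *\<^sub>R h)"
proof (rule norm_deriv_geI)
  fix t :: real assume t: "0 < t"
  have "norm_deriv p h \<le> (norm (p + (t * c) *\<^sub>R h) - norm p) / (t * c)"
    by (rule norm_deriv_le_quotient) (use t assms in simp)
  then show "c * norm_deriv p h \<le> (norm (p + t *\<^sub>R (c *\<^sub>R h)) - norm p) / t"
    using t assms by (simp add: field_simps)
qed

lemma norm_deriv_scale:
  assumes "0 \<le> c"
  shows "norm_deriv p (c *\<^sub>R h) = c * norm_deriv p h"
proof (cases "c = 0")
  case False
  then have c: "0 < c" using assms by simp
  have "(1 / c) * norm_deriv p (c *\<^sub>R h) \<le> norm_deriv p ((1 / c) *\<^sub>R (c *\<^sub>R h))"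
    by (rule norm_deriv_scale_le) (use c in simp)
  then have "norm_deriv p (c *\<^sub>R h) \<le> c * norm_deriv p h"
    using c by (simp add: field_simps)
  then show ?thesis using norm_deriv_scale_le[OF c, of p h] by simp
qed simp

text \<open>Shrinking a step never raises its quotient, so the smaller of two good steps serves both
  points.\<close>

lemma norm_deriv_less2E:
  assumes "norm_deriv p h < a" "norm_deriv q k < b"
  obtains r where "0 < r"
    "(norm (p + r *\<^sub>R h) - norm p) / r < a" "(norm (q + r *\<^sub>R k) - norm q) / r < b"
proof -
  obtain s where s: "0 < s" "(norm (p + s *\<^sub>R h) - norm p) / s < a"
    using assms(1) by (rule norm_deriv_lessE)
  obtain t where t: "0 < t" "(norm (q + t *\<^sub>R k) - norm q) / t < b"
    using assms(2) by (rule norm_deriv_lessE)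
  have r: "0 < min s t" "min s t \<le> s" "min s t \<le> t" using s t by auto
  show thesis
  proof
    show "(norm (p + min s t *\<^sub>R h) - norm p) / min s t < a"
      using norm_quotient_mono[OF r(1,2), of p h] s by linarith
    show "(norm (q + min s t *\<^sub>R k) - norm q) / min s t < b"
      using norm_quotient_mono[OF r(1,3), of q k] t by linarith
  qed (rule r)
qed

lemma norm_deriv_add_le: "norm_deriv p (h + k) \<le> norm_deriv p h + norm_deriv p k"
proof (rule field_le_epsilon)
  fix e :: real assume e: "0 < e"
  obtain r where r: "0 < r"
    and a: "(norm (p + r *\<^sub>R h) - norm p) / r < norm_deriv p h + e / 2"
    and b: "(norm (p + r *\<^sub>R k) - norm p) / r < norm_deriv p k + e / 2"
    using norm_deriv_less2E[of p h "norm_deriv p h + e / 2" p k "norm_deriv p k + e / 2"] e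
    by auto
  \<comment> \<open>The midpoint of \<open>p + r *\<^sub>R h\<close> and
    \<open>p + r *\<^sub>R k\<close>, which halves the step.\<close>
  let ?m = "p + (r / 2) *\<^sub>R (h + k)"
  have "2 *\<^sub>R ?m = (p + r *\<^sub>R h) + (p + r *\<^sub>R k)"
    by (simp add: algebra_simps scaleR_2)
  then have m: "2 * norm ?m \<le> norm (p + r *\<^sub>R h) + norm (p + r *\<^sub>R k)"
    by (metis abs_numeral norm_scaleR norm_triangle_ineq)
  have "norm_deriv p (h + k) \<le> (norm ?m - norm p) / (r / 2)"
    by (rule norm_deriv_le_quotient) (use r in simp)
  also have "\<dots> = (2 * norm ?m - 2 * norm p) / r" by simp
  also have "\<dots> \<le> ((norm (p + r *\<^sub>R h) - norm p) + (norm (p + r *\<^sub>R k) - norm p)) / r"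
    by (rule divide_right_mono) (use m r in linarith)+
  also have "\<dots> = (norm (p + r *\<^sub>R h) - norm p) / r + (norm (p + r *\<^sub>R k) - norm p) / r"
    by (rule add_divide_distrib)
  finally show "norm_deriv p (h + k) \<le> norm_deriv p h + norm_deriv p k + e"
    using a b by linarith
qed

lemma norm_deriv_minus_ge: "- norm_deriv p (- h) \<le> norm_deriv p h"
  using norm_deriv_add_le[of p h "- h"] by simp

text \<open>Gateaux differentiability of the norm at \<open>p\<close> in direction \<open>h\<close>:
  the left-hand derivative is \<open>- norm_deriv p (- h)\<close>.\<close>

definition norm_smooth :: "'a::real_normed_vector \<Rightarrow> 'a \<Rightarrow> bool" where
  "norm_smooth p h \<longleftrightarrow> norm_deriv p (- h) = - norm_deriv p h"

text \<open>Subadditivity towards \<open>h + k\<close> gives the upper bound; towards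
  \<open>- (h + k)\<close>, together with \<open>norm_deriv_minus_ge\<close>, it gives the matching
  lower bound.\<close>

lemma norm_deriv_add:
  assumes "norm_smooth p h" "norm_smooth p k"
  shows "norm_deriv p (h + k) = norm_deriv p h + norm_deriv p k"
    and "norm_smooth p (h + k)"
proof -
  have "norm_deriv p (- (h + k)) \<le> - norm_deriv p h - norm_deriv p k"
    using norm_deriv_add_le[of p "- h" "- k"] assms by (simp add: norm_smooth_def)
  moreover have "- norm_deriv p (- (h + k)) \<le> norm_deriv p (h + k)"
    by (rule norm_deriv_minus_ge)
  moreover have "norm_deriv p (h + k) \<le> norm_deriv p h + norm_deriv p k"
    by (rule norm_deriv_add_le)
  ultimately show "norm_deriv p (h + k) = norm_deriv p h + norm_deriv p k"
    and "norm_smooth p (h + k)"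
    unfolding norm_smooth_def by linarith+
qed

text \<open>A bound on the symmetric second difference. Asking for a single \<open>t\<close> makes
  the set a union of open sets, and by monotonicity that \<open>t\<close> already controls both
  one-sided derivatives.\<close>

definition almost_smooth :: "'a::real_normed_vector \<Rightarrow> real \<Rightarrow> 'a set" where
  "almost_smooth h e =
    {p. \<exists>t>0. norm (p + t *\<^sub>R h) + norm (p - t *\<^sub>R h) < 2 * norm p + t * e}"

lemma norm_smoothI:
  assumes "\<And>n. p \<in> almost_smooth h (inverse (real (Suc n)))"
  shows "norm_smooth p h"
proof -
  have "norm_deriv p h + norm_deriv p (- h) \<le> 0"
  proof (rule field_le_epsilon)
    fix e :: real assume "0 < e"
    then obtain n where n: "inverse (real (Suc n)) < e" using reals_Archimedean by blast
    obtain t where t: "0 < t"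
      "norm (p + t *\<^sub>R h) + norm (p - t *\<^sub>R h) < 2 * norm p + t * inverse (real (Suc n))"
      using assms[of n] unfolding almost_smooth_def by blast
    have "t * inverse (real (Suc n)) < t * e"
      using t n by (intro mult_strict_left_mono)
    with t(2) have le: "norm (p + t *\<^sub>R h) + norm (p - t *\<^sub>R h) - 2 * norm p \<le> t * e"
      by linarith
    have "norm_deriv p h + norm_deriv p (- h)
        \<le> (norm (p + t *\<^sub>R h) - norm p) / t + (norm (p + t *\<^sub>R (- h)) - norm p) / t"
      using norm_deriv_le_quotient t by (intro add_mono)
    also have "\<dots> = (norm (p + t *\<^sub>R h) + norm (p - t *\<^sub>R h) - 2 * norm p) / t"
      by (simp flip: add_divide_distrib)
    also have "\<dots> \<le> e" using t(1) le by (simp add: pos_divide_le_eq mult.commute)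
    finally show "norm_deriv p h + norm_deriv p (- h) \<le> 0 + e" by simp
  qed
  then show ?thesis using norm_deriv_minus_ge[of p h] by (simp add: norm_smooth_def)
qed

section \<open>Density of the points of smoothness\<close>

lemma open_almost_smooth: "open (almost_smooth h e)"
proof -
  have "almost_smooth h e =
      (\<Union>t\<in>{0<..}. {p. norm (p + t *\<^sub>R h) + norm (p - t *\<^sub>R h) < 2 * norm p + t * e})"
    by (auto simp: almost_smooth_def)
  also have "open \<dots>"
    by (intro open_UN ballI open_Collect_less continuous_intros)
  finally show ?thesis .
qed

lemma almost_smooth_scale:
  assumes "p \<in> almost_smooth h e" "0 < c"
  shows "c *\<^sub>R p \<in> almost_smooth h e"
proof -
  obtain t where t: "0 < t" "norm (p + t *\<^sub>R h) + norm (p - t *\<^sub>R h) < 2 * norm p + t * e"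
    using assms by (auto simp: almost_smooth_def)
  have "norm (c *\<^sub>R p + (c * t) *\<^sub>R h) = c * norm (p + t *\<^sub>R h)"
    "norm (c *\<^sub>R p - (c * t) *\<^sub>R h) = c * norm (p - t *\<^sub>R h)"
    using assms(2) by (simp_all flip: scaleR_scaleR scaleR_add_right scaleR_diff_right)
  moreover have "c * (norm (p + t *\<^sub>R h) + norm (p - t *\<^sub>R h)) < c * (2 * norm p + t * e)"
    using t assms(2) by simp
  ultimately show ?thesis
    unfolding almost_smooth_def using t assms(2)
    by (auto intro!: exI[of _ "c * t"] simp: algebra_simps)
qed

text \<open>Along the line through \<open>p\<close>, each step of length \<open>t\<close> that avoids the set raises the slope of
  the norm by at least \<open>e\<close>, while the slope always stays between \<open>- norm h\<close> and \<open>norm h\<close>.\<close>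

lemma almost_smooth_dense:
  assumes "0 < e" "0 < d"
  obtains q where "q \<in> almost_smooth h e" "dist q p < d"
proof -
  \<comment> \<open>So many slope increases by \<open>e\<close> exceed the whole range
    \<open>2 * norm h\<close> of slopes.\<close>
  obtain m :: nat where m: "2 * norm h < m * e"
    using assms(1) reals_Archimedean3 by blast
  \<comment> \<open>With this length \<open>m\<close> steps move by less than \<open>d\<close>; the
    added ones keep the denominator positive.\<close>
  define t where "t = d / ((real m + 1) * (norm h + 1))"
  have den: "0 < (real m + 1) * (norm h + 1)" by (intro mult_pos_pos) (auto simp: add_nonneg_pos)
  have t: "0 < t" unfolding t_def by (rule divide_pos_pos[OF assms(2) den])
  have far: "t * m * norm h < d"
  proof -
    have "(real m + 1) * (norm h + 1) = real m * norm h + (real m + norm h + 1)"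
      by (simp add: algebra_simps)
    moreover have "0 < real m + norm h + 1"
      by (intro add_nonneg_pos add_nonneg_nonneg) auto
    ultimately have "real m * norm h < (real m + 1) * (norm h + 1)" by linarith
    then have "t * (real m * norm h) < t * ((real m + 1) * (norm h + 1))"
      using t by (rule mult_strict_left_mono)
    also have "\<dots> = d"
      unfolding t_def using den by (metis nonzero_divide_eq_eq less_irrefl)
    finally show ?thesis by simp
  qed
  define g where "g k = norm (p + (t * real k) *\<^sub>R h)" for k
  have "\<exists>k\<le>m. p + (t * real k) *\<^sub>R h \<in> almost_smooth h e"
  proof (rule ccontr)
    assume "\<not> ?thesis"
    then have out: "p + (t * real k) *\<^sub>R h \<notin> almost_smooth h e" if "k \<le> m" for k
      using that by blast
    have step: "g (Suc (Suc k)) - g (Suc k) \<ge> g (Suc k) - g k + t * e" if "Suc k \<le> m" for k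
    proof -
      have eq: "p + (t * real (Suc k)) *\<^sub>R h + t *\<^sub>R h = p + (t * real (Suc (Suc k))) *\<^sub>R h"
        "p + (t * real (Suc k)) *\<^sub>R h - t *\<^sub>R h = p + (t * real k) *\<^sub>R h"
        by (simp_all add: algebra_simps flip: scaleR_add_left)
      have "2 * g (Suc k) + t * e \<le> norm (p + (t * real (Suc k)) *\<^sub>R h + t *\<^sub>R h)
          + norm (p + (t * real (Suc k)) *\<^sub>R h - t *\<^sub>R h)"
        using out[OF that] t unfolding almost_smooth_def g_def mem_Collect_eq not_ex by force
      then show ?thesis unfolding eq g_def by linarith
    qed
    have "g (Suc k) - g k \<ge> g 1 - g 0 + t * e * real k" if "k \<le> m" for k
      using that
    proof (induction k)
      case (Suc k)
      then show ?case using step[of k] by (simp add: algebra_simps)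
    qed simp
    from this[of m] have rise: "g (Suc m) - g m \<ge> g (Suc 0) - g 0 + t * (e * m)" by simp
    have lip: "\<bar>g (Suc k) - g k\<bar> \<le> t * norm h" for k
    proof -
      have "\<bar>g (Suc k) - g k\<bar>
          \<le> norm (p + (t * real (Suc k)) *\<^sub>R h - (p + (t * real k) *\<^sub>R h))"
        unfolding g_def by (rule norm_triangle_ineq3)
      also have "\<dots> = t * norm h" using t by (simp add: algebra_simps)
      finally show ?thesis .
    qed
    have "t * (e * m) \<le> 2 * (t * norm h)"
      using rise lip[of m] lip[of 0] unfolding abs_le_iff by linarith
    then have "t * (e * m) \<le> t * (2 * norm h)" by simp
    then show False using t m by (simp add: mult.commute)
  qed
  then obtain k where k: "k \<le> m" "p + (t * real k) *\<^sub>R h \<in> almost_smooth h e" by blast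
  have "t * k * norm h \<le> t * m * norm h"
    using k t by (intro mult_right_mono mult_left_mono) auto
  also note far
  finally have "dist (p + (t * real k) *\<^sub>R h) p < d"
    using t by (simp add: dist_norm)
  with k that show thesis by blast
qed

lemma dist_normalize_le:
  fixes q p :: "'a::real_normed_vector"
  assumes "norm p = 1" "q \<noteq> 0"
  shows "dist (q /\<^sub>R norm q) p \<le> 2 * dist q p"
proof -
  have "q /\<^sub>R norm q - q = (1 / norm q - 1) *\<^sub>R q"
    by (simp add: algebra_simps inverse_eq_divide)
  then have "norm (q /\<^sub>R norm q - q) = \<bar>1 / norm q - 1\<bar> * norm q" by simp
  also have "\<dots> = \<bar>(1 / norm q - 1) * norm q\<bar>" by (simp add: abs_mult)
  also have "\<dots> = \<bar>norm p - norm q\<bar>" using assms by (simp add: left_diff_distrib)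
  also have "\<dots> \<le> dist q p"
    by (metis dist_norm norm_minus_commute norm_triangle_ineq3)
  finally show ?thesis
    using dist_triangle[of "q /\<^sub>R norm q" p q] by (simp add: dist_norm)
qed

lemma sphere_subset_closure_almost_smooth:
  assumes "0 < e"
  shows "sphere 0 1 \<subseteq> closure (sphere (0::'a::real_normed_vector) 1 \<inter> almost_smooth h e)"
proof
  fix p :: 'a assume p: "p \<in> sphere 0 1"
  show "p \<in> closure (sphere 0 1 \<inter> almost_smooth h e)"
    unfolding closure_approachable
  proof (intro allI impI)
    fix d :: real assume d: "0 < d"
    \<comment> \<open>Normalization at most doubles the distance, hence \<open>d / 2\<close>;
      distance below 1 from a unit vector keeps \<open>q\<close> nonzero.\<close>
    obtain q where q: "q \<in> almost_smooth h e" "dist q p < min (d / 2) 1"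
      using almost_smooth_dense[OF assms, of "min (d / 2) 1" h p] d by auto
    have "q \<noteq> 0" using q p by auto
    then have "inverse (norm q) *\<^sub>R q \<in> sphere 0 1 \<inter> almost_smooth h e"
      using almost_smooth_scale[OF q(1), of "inverse (norm q)"] by simp
    moreover have "dist (inverse (norm q) *\<^sub>R q) p < d"
      using dist_normalize_le[of p q] p q(2) \<open>q \<noteq> 0\<close> by simp
    ultimately show "\<exists>y\<in>sphere 0 1 \<inter> almost_smooth h e. dist y p < d" by blast
  qed
qed

text \<open>Openness is continuity. For density, a point of \<open>U\<close> near the image of
  \<open>a\<close> has, by surjectivity, a preimage at the same distance from
  \<open>a\<close>.\<close>

lemma isometry_on_preimage_open_dense:
  fixes \<phi> :: "'a::metric_space \<Rightarrow> 'b::metric_space"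
  assumes iso: "isometry_on A \<phi>" and onto: "\<phi> ` A = B"
    and "open U" and dense: "B \<subseteq> closure (B \<inter> U)"
  shows "openin (top_of_set A) (A \<inter> \<phi> -` U)" and "A \<subseteq> closure (A \<inter> \<phi> -` U)"
proof -
  have "continuous_on A \<phi>"
    unfolding continuous_on_iff using iso by (metis isometry_on_def)
  then show "openin (top_of_set A) (A \<inter> \<phi> -` U)"
    by (rule continuous_openin_preimage_gen[OF _ \<open>open U\<close>])
  show "A \<subseteq> closure (A \<inter> \<phi> -` U)"
  proof
    fix a assume a: "a \<in> A"
    show "a \<in> closure (A \<inter> \<phi> -` U)"
      unfolding closure_approachable
    proof (intro allI impI)
      fix d :: real assume "0 < d"
      moreover have "\<phi> a \<in> closure (B \<inter> U)" using a onto dense by blast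
      ultimately obtain y where y: "y \<in> B \<inter> U" "dist y (\<phi> a) < d"
        unfolding closure_approachable by blast
      then obtain x where x: "x \<in> A" "y = \<phi> x" using onto by blast
      have "dist x a = dist y (\<phi> a)" using iso a x by (simp add: isometry_on_def)
      then show "\<exists>y\<in>A \<inter> \<phi> -` U. dist y a < d"
        using x y by (intro bexI[of _ x]) auto
    qed
  qed
qed

text \<open>Baire's theorem in the unit sphere, which is complete as a closed subset of a Banach
  space. Every direction and every \<open>n\<close> contribute one open dense set, pulled back along
  the isometry for the pairs in \<open>\<Phi>\<close>.\<close>

lemma dense_norm_smooth:
  fixes \<Phi> :: "(('a::banach \<Rightarrow> 'b::real_normed_vector) \<times> 'b) set"
  assumes "countable \<Phi>" and "countable \<Psi>"
    and \<Phi>: "\<And>\<phi> h. (\<phi>, h) \<in> \<Phi> \<Longrightarrow>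
      isometry_on (sphere 0 1) \<phi> \<and> \<phi> ` sphere 0 1 = sphere 0 1"
    and z: "z \<in> sphere 0 1" and "0 < d"
  obtains p where "p \<in> sphere 0 1" "dist p z < d"
    "\<And>h. h \<in> \<Psi> \<Longrightarrow> norm_smooth p h"
    "\<And>\<phi> h. (\<phi>, h) \<in> \<Phi> \<Longrightarrow> norm_smooth (\<phi> p) h"
proof -
  let ?S = "sphere (0::'a) 1"
  define \<G> where "\<G> =
    (\<lambda>((\<phi>, h), n). ?S \<inter> \<phi> -` almost_smooth h (inverse (real (Suc n)))) ` (\<Phi> \<times> UNIV) \<union>
    (\<lambda>(h, n). ?S \<inter> almost_smooth h (inverse (real (Suc n)))) ` (\<Psi> \<times> UNIV)"
  \<comment> \<open>Inserting the sphere keeps the intersection inside it even when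
    \<open>\<G>\<close> is empty.\<close>
  have "top_of_set ?S closure_of \<Inter> (insert ?S \<G>) = topspace (top_of_set ?S)"
  proof (rule Baire_category)
    show "completely_metrizable_space (top_of_set ?S) \<or>
        locally_compact_space (top_of_set ?S) \<and> regular_space (top_of_set ?S)"
    proof -
      have "closed ?S" unfolding sphere_def
        by (intro closed_Collect_eq continuous_intros)
      then show ?thesis
        by (intro disjI1 completely_metrizable_space_closedin
            completely_metrizable_space_euclidean) simp
    qed
    show "countable (insert ?S \<G>)" unfolding \<G>_def using assms(1,2) by auto
    fix G assume "G \<in> insert ?S \<G>"
    then have "openin (top_of_set ?S) G \<and> ?S \<subseteq> closure G"
    proof
      assume "G \<in> \<G>"
      then consider \<phi> h n where "(\<phi>, h) \<in> \<Phi>"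
          "G = ?S \<inter> \<phi> -` almost_smooth h (inverse (real (Suc n)))"
        | h n where "G = ?S \<inter> almost_smooth h (inverse (real (Suc n)))"
        unfolding \<G>_def by auto
      then show ?thesis
      proof cases
        case 1
        have e: "0 < inverse (real (Suc n))" by simp
        show ?thesis
          using isometry_on_preimage_open_dense[OF _ _ open_almost_smooth
              sphere_subset_closure_almost_smooth[OF e, of h], of ?S \<phi>] \<Phi>[OF 1(1)] 1(2)
          by metis
      next
        case 2
        then show ?thesis
          using sphere_subset_closure_almost_smooth[of "inverse (real (Suc n))" h]
            open_almost_smooth openin_open_Int by fastforce
      qed
    qed (simp add: closure_subset)
    moreover from this have "G \<subseteq> ?S" using openin_imp_subset by blast
    ultimately show "openin (top_of_set ?S) G \<and>
        top_of_set ?S closure_of G = topspace (top_of_set ?S)"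
      by (auto simp: closure_of_subtopology Int_absorb1)
  qed
  then have "z \<in> top_of_set ?S closure_of \<Inter> (insert ?S \<G>)" using z by simp
  then have "z \<in> euclidean closure_of \<Inter> (insert ?S \<G>)"
    by (rule subsetD[OF closure_of_subtopology_subset])
  then have "z \<in> closure (\<Inter> (insert ?S \<G>))" by (simp only: euclidean_closure_of)
  then obtain p where p: "p \<in> \<Inter> (insert ?S \<G>)" "dist p z < d"
    using \<open>0 < d\<close> unfolding closure_approachable by blast
  show thesis
  proof
    show "p \<in> ?S" "dist p z < d" using p by auto
    show "norm_smooth p h" if "h \<in> \<Psi>" for h
    proof (rule norm_smoothI)
      fix n
      have "?S \<inter> almost_smooth h (inverse (real (Suc n))) \<in> \<G>"
        unfolding \<G>_def using that by (intro UnI2) force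
      then show "p \<in> almost_smooth h (inverse (real (Suc n)))" using p by blast
    qed
    show "norm_smooth (\<phi> p) h" if "(\<phi>, h) \<in> \<Phi>" for \<phi> h
    proof (rule norm_smoothI)
      fix n
      have "?S \<inter> \<phi> -` almost_smooth h (inverse (real (Suc n))) \<in> \<G>"
        unfolding \<G>_def using that by (intro UnI1) force
      then show "\<phi> p \<in> almost_smooth h (inverse (real (Suc n)))" using p by blast
    qed
  qed
qed

section \<open>Lush spaces\<close>

lemma convex_slice: "convex (slice f e)"
proof -
  have "slice f e = cball 0 1 \<inter> {z. blinfun_apply f z > 1 - e}"
    by (auto simp: slice_def)
  moreover have "convex {z. blinfun_apply f z > 1 - e}"
  proof -
    have "{z. blinfun_apply f z > 1 - e} = blinfun_apply f -` {1 - e<..}" by auto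
    then show ?thesis
      by (metis convex_linear_vimage convex_real_interval(3) blinfun.bounded_linear_right
          bounded_linear.linear)
  qed
  ultimately show ?thesis by (simp add: convex_Int)
qed

text \<open>Symmetry absorbs the signs of the coefficients into the vectors. What remains is a
  convex combination shrunk towards 0, and 0 is the midpoint of \<open>x\<close> and
  \<open>- x\<close>.\<close>

lemma absolutely_convexI:
  fixes C :: "'a::real_vector set"
  assumes "convex C" and sym: "\<And>x. x \<in> C \<Longrightarrow> - x \<in> C"
  shows "absolutely_convex C"
  unfolding absolutely_convex_def
proof (intro ballI allI impI)
  fix x y a b assume x: "x \<in> C" and y: "y \<in> C" and ab: "\<bar>a\<bar> + \<bar>b\<bar> \<le> (1::real)"
  have scale: "\<exists>z'\<in>C. c *\<^sub>R z = \<bar>c\<bar> *\<^sub>R z'" if "z \<in> C" for c and z :: 'a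
    using that sym[OF that] by (cases "0 \<le> c") (force simp: abs_if)+
  obtain x' where x': "x' \<in> C" "a *\<^sub>R x = \<bar>a\<bar> *\<^sub>R x'" using scale[OF x] by blast
  obtain y' where y': "y' \<in> C" "b *\<^sub>R y = \<bar>b\<bar> *\<^sub>R y'" using scale[OF y] by blast
  have "(1/2) *\<^sub>R x + (1/2) *\<^sub>R (- x) \<in> C"
    using assms x by (intro convexD) auto
  then have "0 \<in> C" by simp
  define c where "c = \<bar>a\<bar> + \<bar>b\<bar>"
  have "\<bar>a\<bar> *\<^sub>R x' + \<bar>b\<bar> *\<^sub>R y' \<in> C"
  proof (cases "c = 0")
    case True
    then have "a = 0" "b = 0" by (simp_all add: c_def)
    then show ?thesis using \<open>0 \<in> C\<close> by simp
  next
    case False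
    then have c: "0 < c" by (simp add: c_def)
    have "(\<bar>a\<bar> / c) *\<^sub>R x' + (\<bar>b\<bar> / c) *\<^sub>R y' \<in> C"
      using c by (intro convexD[OF \<open>convex C\<close> x'(1) y'(1)])
        (auto simp: c_def simp flip: add_divide_distrib)
    then have "c *\<^sub>R ((\<bar>a\<bar> / c) *\<^sub>R x' + (\<bar>b\<bar> / c) *\<^sub>R y') + (1 - c) *\<^sub>R 0 \<in> C"
      using c ab by (intro convexD[OF \<open>convex C\<close> _ \<open>0 \<in> C\<close>]) (auto simp: c_def)
    then show ?thesis using c by (simp add: scaleR_add_right)
  qed
  then show "a *\<^sub>R x + b *\<^sub>R y \<in> C" using x' y' by simp
qed

text \<open>The distance estimates to a slice and to its negative hold on the slice itself and are
  stable under absolutely convex combinations, hence hold near \<open>x\<close>. Points of the slice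
  are then normalized, as \<open>T\<close> is controlled only on the sphere.\<close>

lemma lush_approx:
  fixes p x :: "'a::banach"
  assumes "lush TYPE('a)" and p: "norm p = 1" and x: "norm x = 1" and "0 < e"
  obtains f u v where "norm (f :: 'a \<Rightarrow>\<^sub>L real) = 1" "1 - e < f p"
    "norm u = 1" "1 - e < f u" "norm v = 1" "1 - e < f v"
    "norm (x - u) \<le> 1 - f x + 4 * e" "norm (x + v) \<le> 1 + f x + 4 * e"
proof -
  \<comment> \<open>The cap \<open>1/2\<close> keeps points of the slice away from 0, so that they
    can be normalized.\<close>
  define d where "d = min e (1/2)"
  have d: "0 < d" "d \<le> e" "d \<le> 1/2" using \<open>0 < e\<close> by (auto simp: d_def)
  have "p \<in> sphere 0 1" "x \<in> sphere 0 1" using p x by auto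
  then obtain f where f: "norm (f :: 'a \<Rightarrow>\<^sub>L real) = 1" "p \<in> slice f d"
      "infdist x (aco (slice f d)) < d"
    using assms(1) d(1) unfolding lush_def by (metis mem_sphere_0)
  let ?S = "slice f d"
  have fle: "\<bar>f z\<bar> \<le> norm z" for z using norm_blinfun[of f z] f(1) by simp
  \<comment> \<open>The condition is convex in \<open>y\<close>, since \<open>f\<close> is affine
    and the slice convex. For \<open>y = - s\<close> with \<open>s\<close> in the slice the slack
    \<open>d\<close> is needed: the distance to \<open>s\<close> is at most \<open>2\<close>, while
    \<open>f s > 1 - d\<close>.\<close>
  define A where "A = {y. \<exists>u\<in>?S. norm (y - u) \<le> 1 - f y + d}"
  have "convex A"
  proof (rule convexI)
    fix y z and a b :: real
    assume y: "y \<in> A" and z: "z \<in> A" and ab: "0 \<le> a" "0 \<le> b" "a + b = 1"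
    obtain u where u: "u \<in> ?S" "norm (y - u) \<le> 1 - f y + d" using y by (auto simp: A_def)
    obtain v where v: "v \<in> ?S" "norm (z - v) \<le> 1 - f z + d" using z by (auto simp: A_def)
    have "a *\<^sub>R y + b *\<^sub>R z - (a *\<^sub>R u + b *\<^sub>R v) = a *\<^sub>R (y - u) + b *\<^sub>R (z - v)"
      by (simp add: algebra_simps)
    then have "norm (a *\<^sub>R y + b *\<^sub>R z - (a *\<^sub>R u + b *\<^sub>R v))
        \<le> norm (a *\<^sub>R (y - u)) + norm (b *\<^sub>R (z - v))"
      by (metis norm_triangle_ineq)
    also have "\<dots> \<le> a * (1 - f y + d) + b * (1 - f z + d)"
      using ab u v by (auto intro!: add_mono mult_left_mono)
    also have "\<dots> = (a + b) - f (a *\<^sub>R y + b *\<^sub>R z) + (a + b) * d"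
      by (simp add: blinfun.add_right blinfun.scaleR_right algebra_simps)
    finally have "norm (a *\<^sub>R y + b *\<^sub>R z - (a *\<^sub>R u + b *\<^sub>R v))
        \<le> 1 - f (a *\<^sub>R y + b *\<^sub>R z) + d"
      using ab by simp
    moreover have "a *\<^sub>R u + b *\<^sub>R v \<in> ?S"
      using u v ab by (intro convexD[OF convex_slice])
    ultimately show "a *\<^sub>R y + b *\<^sub>R z \<in> A" unfolding A_def by blast
  qed
  have "?S \<subseteq> A \<inter> uminus ` A"
  proof
    fix s assume s: "s \<in> ?S"
    then have "norm s \<le> 1" "1 - d < f s" by (auto simp: slice_def)
    moreover have "norm (- s - s) \<le> 2 * norm s"
      by (metis norm_minus_cancel norm_triangle_ineq4 mult_2)
    ultimately have "- s \<in> A" "s \<in> A"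
      using s fle[of s] d by (auto simp: A_def blinfun.minus_right intro!: bexI[of _ s])
    then show "s \<in> A \<inter> uminus ` A" by (metis IntI image_eqI minus_minus)
  qed
  moreover have "absolutely_convex (A \<inter> uminus ` A)"
    using \<open>convex A\<close> by (intro absolutely_convexI convex_Int convex_negations) auto
  ultimately have sub: "aco ?S \<subseteq> A \<inter> uminus ` A"
    by (rule hull_minimal)
  have "aco ?S \<noteq> {}" using f(2) hull_subset by fastforce
  then obtain y where y: "y \<in> aco ?S" "dist x y < d"
    using f(3) by (metis infdist_notempty cINF_less_iff bdd_below_image_dist)
  have normalize: "norm (sgn u) = 1 \<and> 1 - e < f (sgn u) \<and> norm (u - sgn u) \<le> d"
    if "u \<in> ?S" for u
  proof -
    have u: "norm u \<le> 1" "1 - d < f u" using that by (auto simp: slice_def)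
    then have n: "1 - d < norm u" using fle[of u] by linarith
    then have pos: "0 < norm u" using d by linarith
    have "f u \<le> f u / norm u"
      using u d pos by (simp add: pos_le_divide_eq mult_left_le)
    moreover have "norm (u - sgn u) = 1 - norm u"
    proof -
      have "u - sgn u = (norm u - 1) *\<^sub>R sgn u"
        using pos by (simp add: sgn_div_norm algebra_simps)
      then show ?thesis using pos u(1) by (simp add: norm_sgn)
    qed
    moreover have "f (sgn u) = f u / norm u"
      by (simp add: sgn_div_norm blinfun.scaleR_right divide_inverse mult.commute)
    ultimately show ?thesis
      using u n pos d by (auto simp: norm_sgn)
  qed
  have fxy: "\<bar>f x - f y\<bar> \<le> d"
    using fle[of "x - y"] y(2) by (simp add: blinfun.diff_right dist_norm)
  obtain u where u: "u \<in> ?S" "norm (y - u) \<le> 1 - f y + d"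
    using sub y(1) by (auto simp: A_def)
  have "- y \<in> A" using sub y(1) by auto
  then obtain v where v: "v \<in> ?S" "norm (- y - v) \<le> 1 + f y + d"
    by (auto simp: A_def blinfun.minus_right)
  show thesis
  proof
    show "norm f = 1" by fact
    show "1 - e < f p" using f(2) d by (auto simp: slice_def)
    show "norm (sgn u) = 1" "1 - e < f (sgn u)" using normalize[OF u(1)] by auto
    show "norm (sgn v) = 1" "1 - e < f (sgn v)" using normalize[OF v(1)] by auto
    \<comment> \<open>Four errors of size \<open>d\<close> add up: approximating \<open>x\<close> by
      \<open>y\<close>, the slack in \<open>A\<close>, replacing \<open>f y\<close> by
      \<open>f x\<close>, and normalizing.\<close>
    have "x - sgn u = (x - y) + (y - u) + (u - sgn u)" by simp
    then have "norm (x - sgn u) \<le> norm (x - y) + norm (y - u) + norm (u - sgn u)"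
      by (metis norm_triangle_le add_right_mono norm_triangle_ineq)
    then show "norm (x - sgn u) \<le> 1 - f x + 4 * e"
      using u(2) y(2) conjunct2[OF conjunct2[OF normalize[OF u(1)]]] fxy d
      unfolding dist_norm by linarith
    have "- (x + sgn v) = (y - x) + (- y - v) + (v - sgn v)" by simp
    then have "norm (x + sgn v) \<le> norm (y - x) + norm (- y - v) + norm (v - sgn v)"
      by (metis norm_minus_cancel norm_triangle_le add_right_mono norm_triangle_ineq)
    then show "norm (x + sgn v) \<le> 1 + f x + 4 * e"
      using v(2) y(2) conjunct2[OF conjunct2[OF normalize[OF v(1)]]] fxy d
      unfolding dist_norm norm_minus_commute[of x y] by linarith
  qed
qed

section \<open>Isometries between unit spheres\<close>

text \<open>Both \<open>p\<close> and \<open>v\<close> nearly norm \<open>f\<close>, so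
  \<open>p\<close> and \<open>- v\<close> are almost at distance 2, while \<open>x\<close> is within
  about \<open>1 + f x\<close> of \<open>- v\<close>. Transported by \<open>T\<close>, this keeps
  \<open>T p - \<delta> *\<^sub>R T x\<close> from being too short. Using \<open>T (- v)\<close>
  avoids any assumption on antipodes.\<close>

lemma norm_deriv_lush_ge:
  fixes T :: "'a::banach \<Rightarrow> 'b::real_normed_vector"
  assumes lush: "lush TYPE('a)"
    and iso: "isometry_on (sphere 0 1) T" and into: "T ` sphere 0 1 \<subseteq> sphere 0 1"
    and p: "norm p = 1" and x: "norm x = 1"
  shows "- norm_deriv p x \<le> norm_deriv (T p) (- T x)"
proof (rule norm_deriv_geI)
  fix \<delta> :: real assume \<delta>: "0 < \<delta>" "\<delta> \<le> 1"
  have T1: "norm (T a) = 1" if "norm a = 1" for a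
    using into that by (metis image_subset_iff mem_sphere_0)
  have Td: "norm (T a - T b) = norm (a - b)" if "norm a = 1" "norm b = 1" for a b
    using iso that by (simp add: isometry_on_def dist_norm)
  have "1 - \<delta> * norm_deriv p x \<le> norm (T p - \<delta> *\<^sub>R T x)"
  proof (rule field_le_epsilon)
    fix e' :: real assume "0 < e'"
    define e where "e = e' / 2"
    have e: "0 < e" using \<open>0 < e'\<close> by (simp add: e_def)
    obtain t where t: "0 < t" "(norm (p + t *\<^sub>R x) - norm p) / t < norm_deriv p x + e / 2"
      using norm_deriv_lessE[of p x "norm_deriv p x + e / 2"] e by auto
    \<comment> \<open>The bound \<open>t * e / 2\<close> absorbs the defect of \<open>f p\<close>
      after division by \<open>t\<close>; \<open>e / 6\<close> makes the final error
      \<open>e + 6 * \<epsilon>\<close> at most \<open>2 * e = e'\<close>.\<close>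
    define \<epsilon> where "\<epsilon> = min (e / 6) (t * e / 2)"
    have \<epsilon>: "0 < \<epsilon>" "\<epsilon> \<le> e / 6" "\<epsilon> \<le> t * e / 2" using e t by (auto simp: \<epsilon>_def)
    obtain f v where f: "norm (f :: 'a \<Rightarrow>\<^sub>L real) = 1" "1 - \<epsilon> < f p" and v: "norm v = 1"
      "1 - \<epsilon> < f v" "norm (x + v) \<le> 1 + f x + 4 * \<epsilon>"
      using lush_approx[OF lush p x \<epsilon>(1)] by metis
    have fle: "f z \<le> norm z" for z using norm_blinfun[of f z] f(1) by simp
    have "f p + t * f x \<le> norm (p + t *\<^sub>R x)"
      using fle[of "p + t *\<^sub>R x"] by (simp add: blinfun.add_right blinfun.scaleR_right)
    also have "\<dots> < 1 + t * (norm_deriv p x + e / 2)"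
      using t p by (simp add: pos_divide_less_eq algebra_simps)
    finally have "t * f x < t * (norm_deriv p x + e)"
      using f(2) \<epsilon>(3) by (simp add: algebra_simps)
    then have fx: "f x < norm_deriv p x + e" using t by simp
    have "2 - 2 * \<epsilon> \<le> norm (p + v)"
      using fle[of "p + v"] f(2) v(2) by (simp add: blinfun.add_right)
    also have "\<dots> = norm (T p - T (- v))" using Td[of p "- v"] p v by simp
    also have "T p - T (- v)
        = (T p - \<delta> *\<^sub>R T x) - (1 - \<delta>) *\<^sub>R T (- v) + \<delta> *\<^sub>R (T x - T (- v))"
      by (simp add: algebra_simps)
    also have "norm \<dots> \<le> norm (T p - \<delta> *\<^sub>R T x) + norm ((1 - \<delta>) *\<^sub>R T (- v))
        + norm (\<delta> *\<^sub>R (T x - T (- v)))"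
      by (meson norm_triangle_le add_right_mono norm_triangle_ineq4)
    also have "\<dots> = norm (T p - \<delta> *\<^sub>R T x) + (1 - \<delta>) + \<delta> * norm (x + v)"
      using \<delta> Td[of x "- v"] T1[of "- v"] x v by simp
    also have "\<dots> \<le> norm (T p - \<delta> *\<^sub>R T x) + (1 - \<delta>) + \<delta> * (1 + norm_deriv p x + e + 4 * \<epsilon>)"
      using \<delta> v fx by simp
    finally have "1 - \<delta> * norm_deriv p x \<le> norm (T p - \<delta> *\<^sub>R T x) + \<delta> * (e + 4 * \<epsilon>) + 2 * \<epsilon>"
      by (simp add: algebra_simps)
    moreover have "\<delta> * (e + 4 * \<epsilon>) \<le> 1 * (e + 4 * \<epsilon>)"
      using \<delta> e \<epsilon> by (intro mult_right_mono) auto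
    ultimately show "1 - \<delta> * norm_deriv p x \<le> norm (T p - \<delta> *\<^sub>R T x) + e'"
      using \<epsilon>(2) e_def unfolding mult_1 by argo
  qed
  then show "- norm_deriv p x \<le> (norm (T p + \<delta> *\<^sub>R (- T x)) - norm (T p)) / \<delta>"
    using \<delta> T1[OF p] by (simp add: pos_le_divide_eq algebra_simps)
qed

text \<open>Moving \<open>p\<close> by \<open>- r *\<^sub>R h\<close> and \<open>q\<close> by
  \<open>r *\<^sub>R h\<close> leaves \<open>p + q\<close> unchanged, so the sum of the two norms,
  minimal at the start, cannot decrease.\<close>

lemma norm_deriv_far_points:
  assumes "norm (p + q) = norm p + norm q"
  shows "0 \<le> norm_deriv p (- h) + norm_deriv q h"
proof (rule ccontr)
  assume "\<not> ?thesis"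
  then have neg: "norm_deriv p (- h) < - norm_deriv q h" by simp
  then obtain c where c: "norm_deriv p (- h) < c" "c < - norm_deriv q h" using dense by blast
  then obtain r where r: "0 < r" "(norm (p + r *\<^sub>R - h) - norm p) / r < c"
      "(norm (q + r *\<^sub>R h) - norm q) / r < - c"
    using norm_deriv_less2E[of p "- h" c q h "- c"] by auto
  then have "norm (p + r *\<^sub>R - h) + norm (q + r *\<^sub>R h) < norm p + norm q"
    by (simp add: pos_divide_less_eq)
  moreover have "norm (p + q) \<le> norm (p + r *\<^sub>R - h) + norm (q + r *\<^sub>R h)"
    using norm_triangle_ineq[of "p + r *\<^sub>R - h" "q + r *\<^sub>R h"] by simp
  ultimately show False using assms by simp
qed

text \<open>It is not known beforehand that \<open>T (- p) = - T p\<close>. But \<open>T p - T (- p)\<close> has norm 2, so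
  \<open>T p\<close> and \<open>- T (- p)\<close> have a common support functional; where both are smooth points, the
  derivatives there coincide.\<close>

lemma norm_deriv_isometry:
  fixes T :: "'a::banach \<Rightarrow> 'b::real_normed_vector"
  assumes lush: "lush TYPE('a)"
    and iso: "isometry_on (sphere 0 1) T" and into: "T ` sphere 0 1 \<subseteq> sphere 0 1"
    and p: "norm p = 1" and x: "norm x = 1"
    and smooth: "norm_smooth p x" "norm_smooth (T p) (T x)" "norm_smooth (- T (- p)) (T x)"
  shows "norm_deriv (T p) (T x) = norm_deriv p x"
proof -
  have T1: "norm (T a) = 1" if "norm a = 1" for a
    using into that by (metis image_subset_iff mem_sphere_0)
  \<comment> \<open>Since \<open>- U (- x) = T x\<close>, applying the one-sided bound to
    \<open>U\<close> in direction \<open>- x\<close> yields the inequality opposite to the one for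
    \<open>T\<close>.\<close>
  define U where "U a = - T (- a)" for a
  have "isometry_on (sphere 0 1) U"
    using iso by (simp add: isometry_on_def U_def dist_norm norm_minus_commute)
  moreover have "U ` sphere 0 1 \<subseteq> sphere 0 1" using T1 by (auto simp: U_def)
  ultimately have "- norm_deriv p (- x) \<le> norm_deriv (U p) (- U (- x))"
    using norm_deriv_lush_ge[OF lush, of U p "- x"] p x by simp
  then have "norm_deriv p x \<le> norm_deriv (U p) (T x)"
    using smooth(1) by (simp add: U_def norm_smooth_def)
  also have "\<dots> \<le> norm_deriv (T p) (T x)"
  proof -
    have "norm (U p + T p) = dist (T p) (T (- p))" by (simp add: U_def dist_norm)
    also have "\<dots> = norm (p + p)" using iso p by (simp add: isometry_on_def dist_norm)
    also have "\<dots> = norm (U p) + norm (T p)"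
      using p T1[of p] T1[of "- p"] by (simp add: U_def flip: scaleR_2)
    finally show ?thesis
      using norm_deriv_far_points[of "U p" "T p" "T x"] smooth(3)
      by (simp add: norm_smooth_def U_def)
  qed
  finally show ?thesis
    using norm_deriv_lush_ge[OF lush iso into p x] smooth(2) by (simp add: norm_smooth_def)
qed

section \<open>Recovery of norms from derivatives, and the radial extension\<close>

lemma norm_smooth_scale:
  assumes "norm_smooth p h" "0 \<le> c"
  shows "norm_smooth p (c *\<^sub>R h)"
  using assms norm_deriv_scale[OF assms(2), of p "- h"] norm_deriv_scale[OF assms(2), of p h]
  by (simp add: norm_smooth_def)

lemma norm_scaleR_sgn: "norm h *\<^sub>R sgn h = (h :: 'a::real_normed_vector)"
  by (cases "h = 0") (simp_all add: sgn_div_norm)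

text \<open>The derivative at \<open>p\<close> towards \<open>p\<close> itself is at least 1;
  subadditivity transfers this to \<open>sgn v\<close> at the cost of the distance.\<close>

lemma norm_deriv_near_ge:
  assumes "norm p = 1"
  shows "norm v * (1 - dist p (sgn v)) \<le> norm_deriv p v"
proof -
  have "norm_deriv p p \<le> norm_deriv p (sgn v) + norm_deriv p (p - sgn v)"
    using norm_deriv_add_le[of p "sgn v" "p - sgn v"] by simp
  then have "1 - dist p (sgn v) \<le> norm_deriv p (sgn v)"
    using norm_deriv_self[of p] norm_deriv_le_norm[of p "p - sgn v"] assms
    by (simp add: dist_norm)
  then have "norm v * (1 - dist p (sgn v)) \<le> norm v * norm_deriv p (sgn v)"
    by (rule mult_left_mono) simp
  also have "\<dots> = norm_deriv p v"
    by (simp add: norm_scaleR_sgn flip: norm_deriv_scale)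
  finally show ?thesis .
qed

lemma norm_le_if_norm_deriv_le:
  assumes "\<And>d. 0 < d \<Longrightarrow> v \<noteq> 0 \<Longrightarrow> \<exists>p. norm p = 1 \<and> dist p (sgn v) < d \<and> norm_deriv p v \<le> c"
    and "0 \<le> c"
  shows "norm v \<le> c"
proof (cases "v = 0")
  case False
  show ?thesis
  proof (rule field_le_epsilon)
    fix e :: real assume e: "0 < e"
    then obtain p where p: "norm p = 1" "dist p (sgn v) < e / norm v" "norm_deriv p v \<le> c"
      using assms(1)[of "e / norm v"] False by auto
    then have "norm v * dist p (sgn v) < e" using False by (simp add: field_simps)
    then show "norm v \<le> c + e"
      using norm_deriv_near_ge[OF p(1), of v] p(3) by (simp add: right_diff_distrib)
  qed
qed (use assms in simp)

text \<open>At the origin the factor \<open>norm x\<close> annihilates \<open>T 0\<close>, about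
  which nothing is assumed.\<close>

definition radial_extension :: "('a::real_normed_vector \<Rightarrow> 'b::real_normed_vector) \<Rightarrow> 'a \<Rightarrow> 'b"
  where "radial_extension T x = norm x *\<^sub>R T (sgn x)"

lemma radial_extension_zero [simp]: "radial_extension T 0 = 0"
  by (simp add: radial_extension_def)

lemma radial_extension_scale:
  assumes "0 \<le> c"
  shows "radial_extension T (c *\<^sub>R x) = c *\<^sub>R radial_extension T x"
proof (cases "c = 0")
  case False
  then have "sgn (c *\<^sub>R x) = sgn x" using assms by (simp add: sgn_scaleR)
  then show ?thesis using assms by (simp add: radial_extension_def)
qed simp

lemma uminus_image_sphere: "uminus ` sphere 0 r = sphere (0::'a::real_normed_vector) r"
proof (intro equalityI subsetI)
  fix x :: 'a assume "x \<in> sphere 0 r"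
  then show "x \<in> uminus ` sphere 0 r" by (intro image_eqI[of _ _ "- x"]) auto
qed auto

lemma common_smooth_point:
  fixes T :: "'a::banach \<Rightarrow> 'b::real_normed_vector"
  assumes lush: "lush TYPE('a)"
    and iso: "isometry_on (sphere 0 1) T" and onto: "T ` sphere 0 1 = sphere 0 1"
    and "finite A" and z: "norm z = 1" and "0 < d"
  obtains p where "norm p = 1" "dist p z < d"
    "\<forall>h\<in>A. norm_smooth p h \<and> norm_smooth (T p) (radial_extension T h) \<and>
      norm_deriv (T p) (radial_extension T h) = norm_deriv p h"
proof -
  \<comment> \<open>Derivatives are compared in unit directions only; positive homogeneity gives the
    other nonzero directions, and 0 is trivial.\<close>
  let ?B = "sgn ` (A - {0})"
  define U where "U a = - T (- a)" for a
  have U: "isometry_on (sphere 0 1) U"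
    using iso by (simp add: isometry_on_def U_def dist_norm norm_minus_commute)
  have U_onto: "U ` sphere 0 1 = sphere 0 1"
  proof -
    have "U ` sphere 0 1 = uminus ` T ` uminus ` sphere 0 1"
      by (simp add: U_def[abs_def] image_image)
    also have "\<dots> = sphere 0 1" by (simp only: uminus_image_sphere onto)
    finally show ?thesis .
  qed
  obtain p where p: "p \<in> sphere 0 1" "dist p z < d"
      "\<And>h. h \<in> ?B \<Longrightarrow> norm_smooth p h"
      "\<And>\<phi> h. (\<phi>, h) \<in> {T, U} \<times> T ` ?B \<Longrightarrow> norm_smooth (\<phi> p) h"
  proof (rule dense_norm_smooth[of "{T, U} \<times> T ` ?B" ?B z d])
    show "countable ({T, U} \<times> T ` ?B)" "countable ?B"
      using \<open>finite A\<close> by (simp_all add: countable_finite)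
    show "isometry_on (sphere 0 1) \<phi> \<and> \<phi> ` sphere 0 1 = sphere 0 1"
      if "(\<phi>, h) \<in> {T, U} \<times> T ` ?B" for \<phi> h
      using that iso onto U U_onto by blast
    show "z \<in> sphere 0 1" "0 < d" using z \<open>0 < d\<close> by simp_all
  qed (rule that)
  have p1: "norm p = 1" using p(1) by simp
  have nonzero: "norm_smooth p (sgn h) \<and> norm_smooth (T p) (T (sgn h)) \<and>
      norm_deriv (T p) (T (sgn h)) = norm_deriv p (sgn h)" if "h \<in> A" "h \<noteq> 0" for h
  proof (intro conjI)
    have h: "sgn h \<in> ?B" using that by blast
    show *: "norm_smooth p (sgn h)" "norm_smooth (T p) (T (sgn h))" using p(3,4) h by auto
    have "norm_smooth (- T (- p)) (T (sgn h))" using p(4)[of U] h by (auto simp: U_def)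
    with * show "norm_deriv (T p) (T (sgn h)) = norm_deriv p (sgn h)"
      using that p1 onto by (intro norm_deriv_isometry[OF lush iso]) (auto simp: norm_sgn)
  qed
  have zero: "norm_smooth q 0" for q :: "'c::real_normed_vector" by (simp add: norm_smooth_def)
  have "norm_smooth p h \<and> norm_smooth (T p) (radial_extension T h) \<and>
      norm_deriv (T p) (radial_extension T h) = norm_deriv p h" if h: "h \<in> A" for h
  proof (cases "h = 0")
    case False
    have "norm_smooth p (norm h *\<^sub>R sgn h)" "norm_smooth (T p) (norm h *\<^sub>R T (sgn h))"
      "norm_deriv (T p) (norm h *\<^sub>R T (sgn h)) = norm_deriv p (norm h *\<^sub>R sgn h)"
      using nonzero[OF h False] by (auto intro: norm_smooth_scale simp: norm_deriv_scale)
    then show ?thesis by (simp add: radial_extension_def norm_scaleR_sgn)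
  qed (simp add: zero)
  then show thesis using p1 p(2) by (intro that) auto
qed

text \<open>At a common smooth point derivatives are additive, so those towards \<open>?v\<close>
  and \<open>?V\<close> agree; choosing the point near either direction recovers either norm. Three
  summands allow one identity to yield oddness, additivity and the isometry property.\<close>

lemma norm_radial_extension_add3:
  fixes T :: "'a::banach \<Rightarrow> 'b::real_normed_vector"
  assumes lush: "lush TYPE('a)"
    and iso: "isometry_on (sphere 0 1) T" and onto: "T ` sphere 0 1 = sphere 0 1"
  shows "norm (radial_extension T h + radial_extension T k + radial_extension T l)
    = norm (h + k + l)"
proof -
  let ?v = "h + k + l"
  let ?V = "radial_extension T h + radial_extension T k + radial_extension T l"
  have point: "\<exists>p. norm p = 1 \<and> dist p z < d \<and> norm_deriv (T p) ?V = norm_deriv p ?v"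
    if z: "norm z = 1" and d: "0 < d" for z d
  proof -
    obtain p where p: "norm p = 1" "dist p z < d"
      "\<forall>x\<in>{h, k, l}. norm_smooth p x \<and> norm_smooth (T p) (radial_extension T x) \<and>
        norm_deriv (T p) (radial_extension T x) = norm_deriv p x"
      by (rule common_smooth_point[OF lush iso onto _ z d, of "{h, k, l}"]) simp
    then have "norm_deriv (T p) ?V = norm_deriv p ?v"
      by (simp add: norm_deriv_add)
    with p(1,2) show ?thesis by (intro exI[of _ p] conjI)
  qed
  show ?thesis
  proof (rule antisym)
    show "norm ?v \<le> norm ?V"
    proof (rule norm_le_if_norm_deriv_le)
      fix d :: real assume "0 < d" "?v \<noteq> 0"
      then have "norm (sgn ?v) = 1" by (simp only: norm_sgn if_False)
      then obtain p where p: "norm p = 1" "dist p (sgn ?v) < d"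
          "norm_deriv (T p) ?V = norm_deriv p ?v"
        using point[OF _ \<open>0 < d\<close>] by blast
      have "norm_deriv p ?v \<le> norm ?V" unfolding p(3)[symmetric] by (rule norm_deriv_le_norm)
      with p(1,2) show "\<exists>p. norm p = 1 \<and> dist p (sgn ?v) < d \<and> norm_deriv p ?v \<le> norm ?V"
        by (intro exI[of _ p] conjI)
    qed simp
    show "norm ?V \<le> norm ?v"
    proof (rule norm_le_if_norm_deriv_le)
      fix d :: real assume d: "0 < d" "?V \<noteq> 0"
      \<comment> \<open>Surjectivity turns the direction of \<open>?V\<close> into some
        \<open>T z\<close>; smooth points near \<open>z\<close> then have images equally near
        \<open>sgn ?V\<close>.\<close>
      then have "sgn ?V \<in> T ` sphere 0 1"
        unfolding onto by (simp only: mem_sphere_0 norm_sgn if_False)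
      then obtain z where z: "norm z = 1" "sgn ?V = T z" by auto
      obtain p where p: "norm p = 1" "dist p z < d" "norm_deriv (T p) ?V = norm_deriv p ?v"
        using point[OF z(1) d(1)] by blast
      have "norm (T p) = 1" using onto p(1) by auto
      moreover have "dist (T p) (sgn ?V) < d"
        using iso p z by (simp add: isometry_on_def)
      moreover have "norm_deriv (T p) ?V \<le> norm ?v" unfolding p(3) by (rule norm_deriv_le_norm)
      ultimately show "\<exists>q. norm q = 1 \<and> dist q (sgn ?V) < d \<and> norm_deriv q ?V \<le> norm ?v"
        by (intro exI[of _ "T p"] conjI)
    qed simp
  qed
qed

theorem corollary3p8:
  fixes T :: "'a::banach \<Rightarrow> 'b::banach"
  assumes lush: "lush TYPE('a)"
    and isometry: "isometry_on (sphere 0 1) T"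
    and onto: "T ` sphere 0 1 = sphere 0 1"
  shows "\<exists>T' :: 'a \<Rightarrow> 'b. linear T' \<and> isometry_on UNIV T' \<and> surj T' \<and>
    (\<forall>x\<in>sphere 0 1. T' x = T x)"
proof -
  let ?T = "radial_extension T"
  note norm3 = norm_radial_extension_add3[OF lush isometry onto]
  have minus: "?T (- x) = - ?T x" for x
    using norm3[of x "- x" 0] by (simp add: add_eq_0_iff)
  have "linear ?T"
  proof (rule linearI)
    fix x y
    show "?T (x + y) = ?T x + ?T y"
      \<comment> \<open>The three vectors sum to 0, so their images do as well, and oddness moves
        the third one across.\<close>
      using norm3[of x y "- (x + y)"] unfolding minus
      by (simp only: add.right_inverse norm_zero norm_eq_zero add_eq_0_iff2 minus_minus)
    fix c :: real
    show "?T (c *\<^sub>R x) = c *\<^sub>R ?T x"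
    proof (cases "0 \<le> c")
      case False
      then show ?thesis using radial_extension_scale[of "- c" T x] minus[of "c *\<^sub>R x"] by simp
    qed (rule radial_extension_scale)
  qed
  moreover have "isometry_on UNIV ?T"
    unfolding isometry_on_def dist_norm
  proof (intro ballI)
    fix x y
    show "norm (?T x - ?T y) = norm (x - y)" using norm3[of x "- y" 0] by (simp add: minus)
  qed
  moreover have "surj ?T"
    unfolding surj_def
  proof
    fix y
    show "\<exists>x. y = ?T x"
    proof (cases "y = 0")
      case False
      then have "sgn y \<in> T ` sphere 0 1" unfolding onto by (simp add: norm_sgn)
      then obtain x where "norm x = 1" "sgn y = T x" by auto
      then have "?T (norm y *\<^sub>R x) = y"
        using norm_scaleR_sgn[of y]
        by (simp add: radial_extension_scale) (simp add: radial_extension_def sgn_div_norm)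
      then show ?thesis by metis
    qed (metis radial_extension_zero)
  qed
  moreover have "\<forall>x\<in>sphere 0 1. ?T x = T x"
    by (simp add: radial_extension_def sgn_div_norm)
  ultimately show ?thesis by blast
qed

end
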